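(* Let $N$ be a positive integer. The set \[ S' = \left\{ \begin{bmatrix} 0 & 1 \\ -1 & \alpha \end{bmatrix} : \alpha \in \mathbb{Z}/N\mathbb{Z} \right\} \] generates $\mathrm{SL}_2(\mathbb{Z}/N\mathbb{Z})$ as a semigroup.
   Context: $\mathrm{SL}_2(\mathbb{Z}/N\mathbb{Z})$ is the group of $2\times 2$ matrices over $\mathbb{Z}/N\mathbb{Z}$ of determinant one. Generating as a semigroup means that every element is a finite nonempty product of elements of $S'$ (no inverses). *)

theory Defs
  imports "HOL-Algebra.IntRing"
begin

text \<open>The integers modulo \<open>N\<close> are the quotient ring \<^const>\<open>ZFact\<close>, which for \<open>N = 1\<close> is the zero ring.
  Types of class \<^class>\<open>comm_ring_1\<close> exclude the zero ring, so matrices are taken over a ring with a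
  carrier.\<close>

datatype 'a mat2 = Mat2 (m11: 'a) (m12: 'a) (m21: 'a) (m22: 'a)

definition mat2_det :: "('a, 'b) ring_scheme \<Rightarrow> 'a mat2 \<Rightarrow> 'a" where
  "mat2_det R A = m11 A \<otimes>\<^bsub>R\<^esub> m22 A \<ominus>\<^bsub>R\<^esub> m12 A \<otimes>\<^bsub>R\<^esub> m21 A"

definition mat2_mult :: "('a, 'b) ring_scheme \<Rightarrow> 'a mat2 \<Rightarrow> 'a mat2 \<Rightarrow> 'a mat2" where
  "mat2_mult R A B = Mat2
     (m11 A \<otimes>\<^bsub>R\<^esub> m11 B \<oplus>\<^bsub>R\<^esub> m12 A \<otimes>\<^bsub>R\<^esub> m21 B)
     (m11 A \<otimes>\<^bsub>R\<^esub> m12 B \<oplus>\<^bsub>R\<^esub> m12 A \<otimes>\<^bsub>R\<^esub> m22 B)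
     (m21 A \<otimes>\<^bsub>R\<^esub> m11 B \<oplus>\<^bsub>R\<^esub> m22 A \<otimes>\<^bsub>R\<^esub> m21 B)
     (m21 A \<otimes>\<^bsub>R\<^esub> m12 B \<oplus>\<^bsub>R\<^esub> m22 A \<otimes>\<^bsub>R\<^esub> m22 B)"

definition SL2 :: "('a, 'b) ring_scheme \<Rightarrow> 'a mat2 monoid" where
  "SL2 R =
     \<lparr> carrier = {A. set_mat2 A \<subseteq> carrier R \<and> mat2_det R A = \<one>\<^bsub>R\<^esub>},
       monoid.mult = mat2_mult R,
       one = Mat2 \<one>\<^bsub>R\<^esub> \<zero>\<^bsub>R\<^esub> \<zero>\<^bsub>R\<^esub> \<one>\<^bsub>R\<^esub> \<rparr>"

lemma group_SL2:
  fixes R (structure)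
  assumes "cring R"
  shows "group (SL2 R)"
proof -
  interpret cring R by fact
  show ?thesis
  proof (rule groupI)
    fix A B assume "A \<in> carrier (SL2 R)" "B \<in> carrier (SL2 R)"
    then obtain a b c d e f g h where [simp]: "A = Mat2 a b c d" "B = Mat2 e f g h"
      and car [simp]: "a \<in> carrier R" "b \<in> carrier R" "c \<in> carrier R" "d \<in> carrier R"
        "e \<in> carrier R" "f \<in> carrier R" "g \<in> carrier R" "h \<in> carrier R"
      and det: "a \<otimes> d \<ominus> b \<otimes> c = \<one>" "e \<otimes> h \<ominus> f \<otimes> g = \<one>"
      by (cases A; cases B) (auto simp: SL2_def mat2_det_def)
    have "(a \<otimes> e \<oplus> b \<otimes> g) \<otimes> (c \<otimes> f \<oplus> d \<otimes> h) \<ominus> (a \<otimes> f \<oplus> b \<otimes> h) \<otimes> (c \<otimes> e \<oplus> d \<otimes> g)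
        = (a \<otimes> d \<ominus> b \<otimes> c) \<otimes> (e \<otimes> h \<ominus> f \<otimes> g)"
      using car by algebra
    then show "A \<otimes>\<^bsub>SL2 R\<^esub> B \<in> carrier (SL2 R)"
      using det by (simp add: SL2_def mat2_det_def mat2_mult_def)
  next
    show "\<one>\<^bsub>SL2 R\<^esub> \<in> carrier (SL2 R)"
      by (simp add: SL2_def mat2_det_def minus_eq)
  next
    fix A B C assume "A \<in> carrier (SL2 R)" "B \<in> carrier (SL2 R)" "C \<in> carrier (SL2 R)"
    then show "A \<otimes>\<^bsub>SL2 R\<^esub> B \<otimes>\<^bsub>SL2 R\<^esub> C = A \<otimes>\<^bsub>SL2 R\<^esub> (B \<otimes>\<^bsub>SL2 R\<^esub> C)"
      by (cases A; cases B; cases C) (simp add: SL2_def mat2_mult_def, algebra)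
  next
    fix A assume "A \<in> carrier (SL2 R)"
    then show "\<one>\<^bsub>SL2 R\<^esub> \<otimes>\<^bsub>SL2 R\<^esub> A = A"
      by (cases A) (simp add: SL2_def mat2_mult_def)
  next
    fix A assume "A \<in> carrier (SL2 R)"
    then obtain a b c d where [simp]: "A = Mat2 a b c d"
      and car [simp]: "a \<in> carrier R" "b \<in> carrier R" "c \<in> carrier R" "d \<in> carrier R"
      and det: "a \<otimes> d \<ominus> b \<otimes> c = \<one>"
      by (cases A) (auto simp: SL2_def mat2_det_def)
    have "d \<otimes> a \<ominus> \<ominus> b \<otimes> \<ominus> c = a \<otimes> d \<ominus> b \<otimes> c" "d \<otimes> a \<oplus> \<ominus> b \<otimes> c = a \<otimes> d \<ominus> b \<otimes> c"
      "\<ominus> c \<otimes> b \<oplus> a \<otimes> d = a \<otimes> d \<ominus> b \<otimes> c" "d \<otimes> b \<oplus> \<ominus> b \<otimes> d = \<zero>" "\<ominus> c \<otimes> a \<oplus> a \<otimes> c = \<zero>"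
      using car by algebra+
    then show "\<exists>B\<in>carrier (SL2 R). B \<otimes>\<^bsub>SL2 R\<^esub> A = \<one>\<^bsub>SL2 R\<^esub>"
      using det by (intro bexI[of _ "Mat2 d (\<ominus> b) (\<ominus> c) a"])
        (simp_all add: SL2_def mat2_det_def mat2_mult_def)
  qed
qed

text \<open>The finite nonempty products of elements of \<open>S\<close>: neither the identity nor inverses are
  added.\<close>

inductive_set generate_semigroup :: "('a, 'b) monoid_scheme \<Rightarrow> 'a set \<Rightarrow> 'a set"
  for G and S where
  incl: "x \<in> S \<Longrightarrow> x \<in> generate_semigroup G S"
| step: "x \<in> S \<Longrightarrow> y \<in> generate_semigroup G S \<Longrightarrow> x \<otimes>\<^bsub>G\<^esub> y \<in> generate_semigroup G S"

definition S' :: "('a, 'b) ring_scheme \<Rightarrow> 'a mat2 set" where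
  "S' R = {Mat2 \<zero>\<^bsub>R\<^esub> \<one>\<^bsub>R\<^esub> (\<ominus>\<^bsub>R\<^esub> \<one>\<^bsub>R\<^esub>) \<alpha> | \<alpha>. \<alpha> \<in> carrier R}"

end

theory Submission
  imports Defs
begin

text \<open>Left multiplication by \<open>M \<alpha> = (0, 1; -1, \<alpha>)\<close> sends a first column \<open>(a, c)\<close> to \<open>(c, \<alpha>c - a)\<close>, which
  for \<open>\<alpha> = a div c\<close> is a step of the Euclidean algorithm on integer representatives. Since
  \<open>M 0 * M (-\<alpha>) * M 0\<close> inverts \<open>M \<alpha>\<close>, these steps can be undone inside the semigroup, so it suffices to
  treat first columns \<open>(u, 0)\<close>. There \<open>u\<close> is a unit, with inverse \<open>v\<close> say, and
  \<open>M v * M u * M v * M 0 * M (-v b) = (u, b; 0, v)\<close>.\<close>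

lemma SL2_mult: "mult (SL2 R) = mat2_mult R"
  by (simp add: SL2_def)

context cring
begin

lemma S'_subset_carrier_SL2: "S' R \<subseteq> carrier (SL2 R)"
  by (auto simp: S'_def SL2_def mat2_det_def) algebra

lemma generate_semigroup_SL2_subset:
  assumes "S \<subseteq> carrier (SL2 R)"
  shows "generate_semigroup (SL2 R) S \<subseteq> carrier (SL2 R)"
proof
  interpret SL: group "SL2 R"
    by (rule group_SL2) (rule cring_axioms)
  fix A assume "A \<in> generate_semigroup (SL2 R) S"
  then show "A \<in> carrier (SL2 R)"
    by induction (use assms in auto)
qed

lemma S'_mult_in_generate_semigroup:
  assumes "\<alpha> \<in> carrier R" "A \<in> generate_semigroup (SL2 R) (S' R)"
  shows "mat2_mult R (Mat2 \<zero> \<one> (\<ominus> \<one>) \<alpha>) A \<in> generate_semigroup (SL2 R) (S' R)"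
  using generate_semigroup.step[of _ "S' R" A "SL2 R"] assms by (auto simp: SL2_mult S'_def)

text \<open>The inverse of \<open>M \<alpha>\<close> is \<open>(\<alpha>, -1; 1, 0)\<close>, itself
  a product of three elements of \<open>S' R\<close>, so a Euclidean step can be reversed by left
  multiplication.\<close>

lemma generate_semigroup_S'_cancel:
  assumes \<alpha>: "\<alpha> \<in> carrier R" and A: "set_mat2 A \<subseteq> carrier R"
    and "mat2_mult R (Mat2 \<zero> \<one> (\<ominus> \<one>) \<alpha>) A \<in> generate_semigroup (SL2 R) (S' R)" (is "?B \<in> _")
  shows "A \<in> generate_semigroup (SL2 R) (S' R)"
proof -
  let ?M = "\<lambda>\<beta>. mat2_mult R (Mat2 \<zero> \<one> (\<ominus> \<one>) \<beta>)"
  have "?M \<zero> (?M (\<ominus> \<alpha>) (?M \<zero> ?B)) \<in> generate_semigroup (SL2 R) (S' R)"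
    by (rule S'_mult_in_generate_semigroup zero_closed a_inv_closed \<alpha> assms(3))+
  moreover have "?M \<zero> (?M (\<ominus> \<alpha>) (?M \<zero> ?B)) = A"
  proof (cases A)
    case (Mat2 a b c d)
    then have "a \<in> carrier R" "b \<in> carrier R" "c \<in> carrier R" "d \<in> carrier R"
      using A by auto
    with \<alpha> show ?thesis
      unfolding Mat2 mat2_mult_def mat2.sel mat2.inject by (intro conjI; algebra)
  qed
  ultimately show ?thesis
    by simp
qed

lemma upper_triangular_in_generate_semigroup_S':
  assumes car: "u \<in> carrier R" "v \<in> carrier R" "b \<in> carrier R" and uv: "u \<otimes> v = \<one>"
  shows "Mat2 u b \<zero> v \<in> generate_semigroup (SL2 R) (S' R)"
proof -
  let ?M = "\<lambda>\<beta>. mat2_mult R (Mat2 \<zero> \<one> (\<ominus> \<one>) \<beta>)"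
  \<comment> \<open>As \<open>uv = 1\<close>, \<open>M v * M u * M v = diag(-u, -v)\<close>, while
    \<open>M 0 * M w = (-1, w; 0, -1)\<close>. The product is \<open>(u, -uw; 0, v)\<close>, and
    \<open>w = -vb\<close> makes the corner \<open>b\<close>.\<close>
  let ?w = "\<ominus> (v \<otimes> b)"
  let ?P = "?M v (?M u (?M v (?M \<zero> (Mat2 \<zero> \<one> (\<ominus> \<one>) ?w))))"
  have "Mat2 \<zero> \<one> (\<ominus> \<one>) ?w \<in> generate_semigroup (SL2 R) (S' R)"
    using car by (intro generate_semigroup.incl) (auto simp: S'_def)
  then have "?P \<in> generate_semigroup (SL2 R) (S' R)"
    using car by (intro S'_mult_in_generate_semigroup) auto
  \<comment> \<open>These entries are polynomial identities that hold before \<open>uv = 1\<close>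
    is used; they are grouped so that rewriting \<open>u \<otimes> v\<close> to
    \<open>\<one>\<close> finishes.\<close>
  moreover have "?P = Mat2 u (u \<otimes> v \<otimes> b \<ominus> u \<otimes> v \<oplus> \<one>) (u \<otimes> v \<ominus> \<one>)
      (v \<oplus> (\<one> \<ominus> u \<otimes> v) \<otimes> (v \<ominus> v \<otimes> b))"
    unfolding mat2_mult_def mat2.sel mat2.inject using car by (intro conjI; algebra)
  moreover have "b \<ominus> \<one> \<oplus> \<one> = b" "\<one> \<ominus> \<one> = \<zero>"
    using car by algebra+
  ultimately show ?thesis
    using car by (simp add: uv)
qed

text \<open>Division with remainder needs integers, so the first column is lifted along
  \<open>h\<close>; the second never steers the descent and stays in \<open>R\<close>. The
  determinant is one only in \<open>R\<close>, so \<open>a\<close> and \<open>c\<close> need not be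
  coprime, and at \<open>c = 0\<close> only \<open>h a\<close> is known to be a unit.\<close>

lemma SL2_int_column_in_generate_semigroup_S':
  fixes a c :: int
  assumes h: "h \<in> ring_hom \<Z> R"
    and "Mat2 (h a) b (h c) d \<in> carrier (SL2 R)"
  shows "Mat2 (h a) b (h c) d \<in> generate_semigroup (SL2 R) (S' R)"
  using assms(2)
proof (induction "nat \<bar>c\<bar>" arbitrary: a b c d rule: less_induct)
  case less
  interpret h: ring_hom_ring \<Z> R h
    using h by (intro ring_hom_ringI2 int.ring_axioms ring_axioms)
  have h_car [simp]: "h x \<in> carrier R" for x
    using h.hom_closed[of x] by simp
  have car: "b \<in> carrier R" "d \<in> carrier R" and det: "h a \<otimes> d \<ominus> b \<otimes> h c = \<one>"
    using less.prems by (auto simp: SL2_def mat2_det_def)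
  show ?case
  proof (cases "c = 0")
    case True
    then have [simp]: "h c = \<zero>"
      using h.hom_zero by simp
    have "h a \<otimes> d = \<one>"
      using det car by (simp add: minus_eq)
    then show ?thesis
      using upper_triangular_in_generate_semigroup_S'[of "h a" d b] car by simp
  next
    case False
    define q where "q = a div c"
    let ?A = "Mat2 (h a) b (h c) d"
    \<comment> \<open>The new lower left entry is the negated remainder, hence the induction on
      \<open>\<bar>c\<bar>\<close>.\<close>
    have "- (a mod c) = q * c - a"
      by (simp add: q_def minus_mod_eq_div_mult [symmetric])
    then have "h (- (a mod c)) = \<ominus> h a \<oplus> h q \<otimes> h c"
      using h.hom_add[of "- a" "q * c"] h.hom_mult[of q c] h.hom_a_inv[of a] by simp
    then have eq: "mat2_mult R (Mat2 \<zero> \<one> (\<ominus> \<one>) (h q)) ?A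
        = Mat2 (h c) d (h (- (a mod c))) (\<ominus> b \<oplus> h q \<otimes> d)"
      using car by (simp add: mat2_mult_def l_minus)
    have "Mat2 \<zero> \<one> (\<ominus> \<one>) (h q) \<in> carrier (SL2 R)"
      using S'_subset_carrier_SL2 by (auto simp: S'_def)
    then have "mat2_mult R (Mat2 \<zero> \<one> (\<ominus> \<one>) (h q)) ?A \<in> carrier (SL2 R)"
      using group.is_monoid[OF group_SL2[OF cring_axioms], THEN monoid.m_closed] less.prems
      by (simp add: SL2_mult)
    moreover have "nat \<bar>- (a mod c)\<bar> < nat \<bar>c\<bar>"
      using abs_mod_less[OF False, of a] by simp
    ultimately have "mat2_mult R (Mat2 \<zero> \<one> (\<ominus> \<one>) (h q)) ?A \<in> generate_semigroup (SL2 R) (S' R)"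
      unfolding eq by (intro less.hyps)
    then show ?thesis
      using generate_semigroup_S'_cancel[of "h q" ?A] car by simp
  qed
qed

text \<open>Surjectivity of \<open>h\<close> lifts the first column of any matrix to integers. The
  zero ring is covered as well.\<close>

theorem generate_semigroup_SL2_S':
  assumes "h \<in> ring_hom \<Z> R" "h ` UNIV = carrier R"
  shows "generate_semigroup (SL2 R) (S' R) = carrier (SL2 R)"
proof
  show "generate_semigroup (SL2 R) (S' R) \<subseteq> carrier (SL2 R)"
    by (intro generate_semigroup_SL2_subset S'_subset_carrier_SL2)
  show "carrier (SL2 R) \<subseteq> generate_semigroup (SL2 R) (S' R)"
  proof
    fix A assume A: "A \<in> carrier (SL2 R)"
    then have "m11 A \<in> range h" "m21 A \<in> range h"
      unfolding assms(2) by (cases A; auto simp: SL2_def)+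
    then obtain a c where "m11 A = h a" "m21 A = h c"
      by blast
    then have "A = Mat2 (h a) (m12 A) (h c) (m22 A)"
      by (cases A) simp
    then show "A \<in> generate_semigroup (SL2 R) (S' R)"
      using SL2_int_column_in_generate_semigroup_S'[OF assms(1)] A by metis
  qed
qed

end

theorem lemma4p1:
  fixes N :: nat
  assumes "N > 0"
  shows "generate_semigroup (SL2 (ZFact (int N))) (S' (ZFact (int N))) = carrier (SL2 (ZFact (int N)))"
proof (rule cring.generate_semigroup_SL2_S')
  \<comment> \<open>The map \<open>h\<close> is the projection to cosets of \<open>?I\<close>, onto
    by the construction of the quotient.\<close>
  let ?I = "Idl\<^bsub>\<Z>\<^esub> {int N}"
  show "cring (ZFact (int N))"
    by (rule ZFact_is_cring)
  have "ideal ?I \<Z>"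
    by (rule int.genideal_ideal) simp
  then show "(+>\<^bsub>\<Z>\<^esub>) ?I \<in> ring_hom \<Z> (ZFact (int N))"
    unfolding ZFact_def by (rule ideal.rcos_ring_hom)
  show "range ((+>\<^bsub>\<Z>\<^esub>) ?I) = carrier (ZFact (int N))"
    by (auto simp: ZFact_def FactRing_def A_RCOSETS_def')
qed

end
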